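(* Let $l,\lambda\ge0$, $|m|\le l$, $|\mu|\le\lambda$, $q\in\{-1,0,1\}$ be integers and let $\alpha$ be the (real) quasi-periodicity parameter. For $n\in\mathbb Z\setminus\{0\}$ put $\mathbf b=(-n,0,0)$. Denote the series $\sum_{n\ne0}b_{-q}H_{l,\lambda}^{m,\mu}(\mathbf b)e^{-in\alpha}$ by $\mathscr A_{l,\lambda}^{m,\mu}(\alpha,q)$. Then $$\mathscr A_{l,\lambda}^{m,\mu}(\alpha,q)=(-1)^{\lambda+\mu}\epsilon_q\sqrt{\frac{2l+1}{2\lambda+1}}\sqrt{\binom{l+\lambda+\mu-m}{\lambda+\mu}\binom{l+\lambda+m-\mu}{\lambda-\mu}}\sqrt{\frac{4\pi}{2(l+\lambda)+1}}\Big(\mathrm{Li}_{l+\lambda}(e^{-i\alpha})Y_{l+\lambda}^{m-\mu}(\tfrac\pi2,\pi)-\mathrm{Li}_{l+\lambda}(e^{i\alpha})Y_{l+\lambda}^{m-\mu}(\tfrac\pi2,0)\Big),$$ where $\epsilon_{-1}=\frac1{\sqrt2}$, $\epsilon_0=0$, $\epsilon_1=-\frac1{\sqrt2}$.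
   Context: $Y_l^m(\theta,\phi)$ are the $L^2$-orthonormal complex spherical harmonics with Condon–Shortley phase ($\theta$ polar, $\phi$ azimuthal angle). $I_l^m(\mathbf r)=\sqrt{\frac{4\pi}{2l+1}}Y_l^m(\hat{\mathbf r})|\mathbf r|^{-l-1}$, $\hat{\mathbf r}=\mathbf r/|\mathbf r|$, and $H_{l,\lambda}^{m,\mu}(\mathbf b)=(-1)^{\lambda+\mu}\sqrt{\frac{2l+1}{2\lambda+1}}\,I_{l+\lambda}^{m-\mu}(\mathbf b)\sqrt{\binom{l+\lambda+\mu-m}{\lambda+\mu}\binom{l+\lambda+m-\mu}{\lambda-\mu}}$. For $\mathbf b=(b_x,b_y,b_z)$, $b_{-q}=\frac1{\sqrt2}(b_x-ib_y)$ if $q=1$, $b_z$ if $q=0$, $-\frac1{\sqrt2}(b_x+ib_y)$ if $q=-1$. The polylogarithm is defined by the series $\mathrm{Li}_s(z)=\sum_{k=1}^\infty z^k/k^s$.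
   Formalization: The identity is stated whenever the parts of the series over n>0 and n<0 both converge; this, and convergence of both Li series, is proved for l+λ≥2, and for l+λ=1 with e^{iα}≠1; otherwise the Li series diverge. *)

theory Defs
  imports "HOL-Analysis.Analysis" "HOL-Computational_Algebra.Polynomial"
begin

text \<open>Legendre polynomials by the Rodrigues formula, and associated Legendre functions of order
  \<open>k \<ge> 0\<close>; the factor \<open>(-1)^k\<close> is the Condon--Shortley phase.\<close>

definition legendre_poly :: "nat \<Rightarrow> real poly" where
  "legendre_poly l = smult (1 / (2 ^ l * fact l)) ((pderiv ^^ l) ([:-1, 0, 1:] ^ l))"

definition assoc_legendre :: "nat \<Rightarrow> nat \<Rightarrow> real \<Rightarrow> real" where
  "assoc_legendre l k x = (-1) ^ k * sqrt (1 - x\<^sup>2) ^ k * poly ((pderiv ^^ k) (legendre_poly l)) x"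

definition sph_harm_nonneg :: "nat \<Rightarrow> nat \<Rightarrow> real \<Rightarrow> real \<Rightarrow> complex" where
  "sph_harm_nonneg l k \<theta> \<phi> =
     of_real (sqrt ((2 * real l + 1) / (4 * pi) * (fact (l - k) / fact (l + k)))
              * assoc_legendre l k (cos \<theta>))
     * exp (\<i> * of_nat k * of_real \<phi>)"

text \<open>Negative orders are given by the symmetry \<open>Y_l^(-k) = (-1)^k cnj (Y_l^k)\<close>. The orders of
  interest are \<open>\<bar>m\<bar> \<le> l\<close>. The polar angle is \<open>\<theta>\<close>, the azimuthal angle is \<open>\<phi>\<close>.\<close>

definition sph_harm :: "nat \<Rightarrow> int \<Rightarrow> real \<Rightarrow> real \<Rightarrow> complex" where
  "sph_harm l m \<theta> \<phi> =
     (if 0 \<le> m then sph_harm_nonneg l (nat m) \<theta> \<phi>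
      else (-1) ^ nat (- m) * cnj (sph_harm_nonneg l (nat (- m)) \<theta> \<phi>))"

text \<open>On unit vectors; \<open>Arg\<close> takes values in \<open>(-\<pi>, \<pi>]\<close>.\<close>

definition sph_harm_vec :: "nat \<Rightarrow> int \<Rightarrow> real ^ 3 \<Rightarrow> complex" where
  "sph_harm_vec l m u = sph_harm l m (arccos (u $ 3)) (Arg (Complex (u $ 1) (u $ 2)))"

definition irreg_harm :: "nat \<Rightarrow> int \<Rightarrow> real ^ 3 \<Rightarrow> complex" where
  "irreg_harm l m r =
     of_real (sqrt (4 * pi / (2 * real l + 1))) * sph_harm_vec l m (r /\<^sub>R norm r)
     * of_real (norm r powi (- int l - 1))"

text \<open>For \<open>\<bar>m\<bar> \<le> l\<close> and \<open>\<bar>\<mu>\<bar> \<le> \<lambda>\<close> all arguments of \<open>nat\<close> below are nonnegative.\<close>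

definition binom_factor :: "nat \<Rightarrow> nat \<Rightarrow> int \<Rightarrow> int \<Rightarrow> real" where
  "binom_factor l lam m \<mu> =
     sqrt (real (nat (int l + int lam + \<mu> - m) choose nat (int lam + \<mu>))
           * real (nat (int l + int lam + m - \<mu>) choose nat (int lam - \<mu>)))"

definition H_coeff :: "nat \<Rightarrow> nat \<Rightarrow> int \<Rightarrow> int \<Rightarrow> real ^ 3 \<Rightarrow> complex" where
  "H_coeff l lam m \<mu> b =
     (-1) powi (int lam + \<mu>) * of_real (sqrt ((2 * real l + 1) / (2 * real lam + 1)))
     * irreg_harm (l + lam) (m - \<mu>) b * of_real (binom_factor l lam m \<mu>)"

text \<open>\<open>sph_comp b p\<close> is the spherical component \<open>b_p\<close>, for \<open>p \<in> {-1, 0, 1}\<close>.\<close>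

definition sph_comp :: "real ^ 3 \<Rightarrow> int \<Rightarrow> complex" where
  "sph_comp b p =
     (if p = -1 then of_real (1 / sqrt 2) * (of_real (b $ 1) - \<i> * of_real (b $ 2))
      else if p = 0 then of_real (b $ 3)
      else - of_real (1 / sqrt 2) * (of_real (b $ 1) + \<i> * of_real (b $ 2)))"

definition eps :: "int \<Rightarrow> real" where
  "eps q = (if q = -1 then 1 / sqrt 2 else if q = 0 then 0 else - 1 / sqrt 2)"

definition polylog_term :: "nat \<Rightarrow> complex \<Rightarrow> nat \<Rightarrow> complex" where
  "polylog_term s z k = z ^ Suc k / of_nat (Suc k) ^ s"

definition polylog :: "nat \<Rightarrow> complex \<Rightarrow> complex" where
  "polylog s z = (\<Sum>k. polylog_term s z k)"

text \<open>A series over the nonzero integers converges if its parts over \<open>n > 0\<close> and over \<open>n < 0\<close>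
  both converge (possibly only conditionally), that is, if the partial sums over
  \<open>-M \<le> n \<le> N\<close> converge as \<open>M\<close> and \<open>N\<close> tend to infinity independently.\<close>

definition summable_nz :: "(int \<Rightarrow> complex) \<Rightarrow> bool" where
  "summable_nz f \<longleftrightarrow>
     summable (\<lambda>k. f (int (Suc k))) \<and> summable (\<lambda>k. f (- int (Suc k)))"

definition suminf_nz :: "(int \<Rightarrow> complex) \<Rightarrow> complex" where
  "suminf_nz f = (\<Sum>k. f (int (Suc k))) + (\<Sum>k. f (- int (Suc k)))"

definition lattice_vec :: "int \<Rightarrow> real ^ 3" where
  "lattice_vec n = vector [- of_int n, 0, 0]"

definition A_term :: "nat \<Rightarrow> nat \<Rightarrow> int \<Rightarrow> int \<Rightarrow> real \<Rightarrow> int \<Rightarrow> int \<Rightarrow> complex" where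
  "A_term l lam m \<mu> \<alpha> q n =
     sph_comp (lattice_vec n) (- q) * H_coeff l lam m \<mu> (lattice_vec n)
     * exp (- \<i> * of_int n * of_real \<alpha>)"

definition A_series :: "nat \<Rightarrow> nat \<Rightarrow> int \<Rightarrow> int \<Rightarrow> real \<Rightarrow> int \<Rightarrow> complex" where
  "A_series l lam m \<mu> \<alpha> q = suminf_nz (A_term l lam m \<mu> \<alpha> q)"

end

theory Submission
  imports Defs
begin

text \<open>The lattice lies on the first coordinate axis, so every angle that enters the
  series is constant on each of its two halves: the vector of index \<open>n\<close> points in direction
  \<open>(\<theta>, \<phi>) = (\<pi>/2, \<pi>)\<close> if \<open>n > 0\<close> and in direction \<open>(\<pi>/2, 0)\<close> if \<open>n < 0\<close>. With \<open>L = l + \<lambda>\<close>,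
  what depends on \<open>n\<close> otherwise is the spherical component, which equals \<open>\<epsilon>_q * n\<close>, the decay
  \<open>\<bar>n\<bar>^(-L-1)\<close> and the phase. Their product is \<open>\<epsilon>_q * sgn n * e^(-i n \<alpha>) / \<bar>n\<bar>^L\<close>, so each half of
  the series is, termwise, a constant multiple of the polylogarithm series of order \<open>L\<close> at
  \<open>e^(-i \<alpha>)\<close> or \<open>e^(i \<alpha>)\<close>; the relative minus sign is that of \<open>n\<close>
  (\<open>A_term_pos\<close>, \<open>A_term_neg\<close>).

  The closed form then holds as soon as the two halves converge. If a constant vanishes, its half
  of the series and its summand of the right-hand side are both zero, whatever value the
  possibly divergent polylogarithm series is assigned; otherwise convergence of the half is
  equivalent to convergence of the polylogarithm series, and the constant can be pulled out.

  The polylogarithm series converges absolutely on the unit circle for \<open>L \<ge> 2\<close>. For \<open>L = 1\<close> and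
  argument \<open>z \<noteq> 1\<close> it converges by Dirichlet's test for decreasing coefficients against the
  powers of \<open>z\<close> (\<open>summable_decseq_mult_power\<close>).\<close>

text \<open>Multiplying the series by \<open>z - 1\<close> turns it into a telescoping series, which converges because
  \<open>a k * z ^ k\<close> tends to zero, plus a series dominated by the telescoping series of the
  nonnegative differences \<open>a k - a (Suc k)\<close>.\<close>

lemma summable_decseq_mult_power:
  fixes a :: "nat \<Rightarrow> real" and z :: complex
  assumes dec: "decseq a" and lim: "a \<longlonglongrightarrow> 0" and z: "norm z \<le> 1" "z \<noteq> 1"
  shows "summable (\<lambda>k. of_real (a k) * z ^ k)"
proof -
  let ?f = "\<lambda>k. of_real (a k) * z ^ k"
  let ?g = "\<lambda>k. of_real (a k - a (Suc k)) * z ^ Suc k"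
  have nonneg: "0 \<le> a k" for k
    using decseq_ge[OF dec lim] .
  have "norm (?f k) \<le> a k" for k
    using nonneg[of k] z(1) by (simp add: norm_mult norm_power power_le_one mult_left_le)
  then have "?f \<longlonglongrightarrow> 0"
    by (intro Lim_null_comparison[OF _ lim]) simp
  then have telescoping: "summable (\<lambda>k. ?f (Suc k) - ?f k)"
    by (rule telescope_summable)
  have "norm (?g k) \<le> a k - a (Suc k)" for k
  proof -
    have diff: "0 \<le> a k - a (Suc k)"
      using decseq_SucD[OF dec] by simp
    have "norm (?g k) = (a k - a (Suc k)) * norm z ^ Suc k"
      using diff by (simp only: norm_mult norm_power norm_of_real abs_of_nonneg)
    also have "\<dots> \<le> a k - a (Suc k)"
      using diff z(1) by (intro mult_left_le power_le_one) auto
    finally show ?thesis .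
  qed
  then have dominated: "summable ?g"
    by (intro summable_comparison_test'[OF telescope_summable'[OF lim]])
  have "(z - 1) * ?f k = (?f (Suc k) - ?f k) + ?g k" for k
    by (simp add: algebra_simps)
  then have "summable (\<lambda>k. (z - 1) * ?f k)"
    using summable_add[OF telescoping dominated] by simp
  with z(2) show ?thesis
    by simp
qed

lemma summable_polylog_term:
  assumes z: "norm z = 1" and s: "s \<ge> 2 \<or> (s = 1 \<and> z \<noteq> 1)"
  shows "summable (polylog_term s z)"
  using s
proof
  assume "s \<ge> 2"
  then have "summable (\<lambda>k. inverse (real (Suc k) ^ s))"
    by (subst summable_Suc_iff) (rule inverse_power_summable)
  moreover have "norm (polylog_term s z k) \<le> inverse (real (Suc k) ^ s)" for k
    using z by (simp only: polylog_term_def norm_divide norm_power norm_of_nat)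
      (simp add: divide_inverse)
  ultimately show ?thesis
    by (rule summable_comparison_test')
next
  assume s: "s = 1 \<and> z \<noteq> 1"
  have "summable (\<lambda>k. of_real (inverse (real (Suc k))) * z ^ k)"
  proof (rule summable_decseq_mult_power)
    show "decseq (\<lambda>k. inverse (real (Suc k)))"
      by (intro decseq_SucI) (simp add: field_simps)
    show "(\<lambda>k. inverse (real (Suc k))) \<longlonglongrightarrow> 0"
      by (rule LIMSEQ_inverse_real_of_nat)
  qed (use z s in auto)
  from summable_mult[OF this, of z] show ?thesis
    using s by (simp add: polylog_term_def[abs_def] divide_inverse mult_ac)
qed

lemma norm_lattice_vec: "norm (lattice_vec n) = \<bar>of_int n\<bar>"
  by (simp add: lattice_vec_def norm_eq_sqrt_inner inner_vec_def sum_3 vector_3)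

lemma sph_comp_lattice_vec:
  assumes "q \<in> {-1, 0, 1}"
  shows "sph_comp (lattice_vec n) (- q) = of_real (eps q) * of_int n"
  using assms by (auto simp: sph_comp_def lattice_vec_def eps_def vector_3)

lemma sph_harm_vec_lattice_vec:
  assumes "n \<noteq> 0"
  shows "sph_harm_vec L M (lattice_vec n /\<^sub>R norm (lattice_vec n))
    = sph_harm L M (pi / 2) (if n > 0 then pi else 0)"
proof -
  let ?u = "lattice_vec n /\<^sub>R norm (lattice_vec n)"
  have "Complex (?u $ 1) (?u $ 2) = (if n > 0 then -1 else 1)"
    unfolding norm_lattice_vec
    using assms by (auto simp: lattice_vec_def vector_3 complex_eq_iff field_simps)
  moreover have "?u $ 3 = 0"
    by (simp add: lattice_vec_def vector_3)
  ultimately show ?thesis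
    using Arg_eq_pi[of "-1"] by (simp only: sph_harm_vec_def arccos_0 split: if_split) simp
qed

definition A_prefactor :: "nat \<Rightarrow> nat \<Rightarrow> int \<Rightarrow> int \<Rightarrow> int \<Rightarrow> complex" where
  "A_prefactor l lam m \<mu> q =
     (-1) powi (int lam + \<mu>) * of_real (eps q)
     * of_real (sqrt ((2 * real l + 1) / (2 * real lam + 1)))
     * of_real (binom_factor l lam m \<mu>)
     * of_real (sqrt (4 * pi / (2 * real (l + lam) + 1)))"

text \<open>The factor \<open>n\<close> from the spherical component lowers the decay \<open>\<bar>n\<bar>^(-L-1)\<close> of the irregular
  harmonic by one power and leaves the sign of \<open>n\<close> behind.\<close>

lemma A_term_eq:
  assumes q: "q \<in> {-1, 0, 1}" and n: "n \<noteq> 0"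
  shows "A_term l lam m \<mu> \<alpha> q n =
    A_prefactor l lam m \<mu> q
    * sph_harm (l + lam) (m - \<mu>) (pi / 2) (if n > 0 then pi else 0)
    * (of_int (sgn n) * exp (- \<i> * of_int n * of_real \<alpha>) / of_int \<bar>n\<bar> ^ (l + lam))"
proof -
  let ?L = "l + lam"
  have "real_of_int n * (\<bar>real_of_int n\<bar> powi (- int ?L - 1)) = of_int (sgn n) / \<bar>of_int n\<bar> ^ ?L"
  proof -
    have "\<bar>real_of_int n\<bar> powi (- int ?L - 1) = inverse (\<bar>of_int n\<bar> ^ Suc ?L)"
      by (simp add: power_int_def nat_add_distrib power_inverse algebra_simps)
    then have "real_of_int n * (\<bar>real_of_int n\<bar> powi (- int ?L - 1))
      = of_int (sgn n) * \<bar>of_int n\<bar> * inverse (\<bar>of_int n\<bar> ^ Suc ?L)"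
      by (simp add: sgn_if)
    also have "\<dots> = of_int (sgn n) / \<bar>of_int n\<bar> ^ ?L"
      using n by (simp add: divide_simps)
    finally show ?thesis .
  qed
  then have "complex_of_real (real_of_int n * (\<bar>real_of_int n\<bar> powi (- int ?L - 1)))
    = of_real (of_int (sgn n) / \<bar>of_int n\<bar> ^ ?L)"
    by (rule arg_cong)
  then have radial: "of_int n * complex_of_real (\<bar>real_of_int n\<bar> powi (- int ?L - 1))
    = of_int (sgn n) / of_int \<bar>n\<bar> ^ ?L"
    by (simp flip: of_int_abs)
  have "A_term l lam m \<mu> \<alpha> q n =
    A_prefactor l lam m \<mu> q
    * sph_harm ?L (m - \<mu>) (pi / 2) (if n > 0 then pi else 0)
    * (of_int n * complex_of_real (\<bar>real_of_int n\<bar> powi (- int ?L - 1)))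
    * exp (- \<i> * of_int n * of_real \<alpha>)"
    unfolding A_term_def sph_comp_lattice_vec[OF q] H_coeff_def irreg_harm_def
      sph_harm_vec_lattice_vec[OF n, unfolded norm_lattice_vec] norm_lattice_vec A_prefactor_def
    by (simp only: mult_ac)
  then show ?thesis
    unfolding radial by simp
qed

lemma A_term_pos:
  assumes "q \<in> {-1, 0, 1}"
  shows "A_term l lam m \<mu> \<alpha> q (int (Suc k)) =
    A_prefactor l lam m \<mu> q * sph_harm (l + lam) (m - \<mu>) (pi / 2) pi
    * polylog_term (l + lam) (exp (- \<i> * of_real \<alpha>)) k"
proof -
  have "exp (- \<i> * of_int (int (Suc k)) * of_real \<alpha>) = exp (- \<i> * of_real \<alpha>) ^ Suc k"
    by (subst exp_of_nat_mult[symmetric]) (simp add: mult_ac del: of_nat_Suc)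
  then show ?thesis
    using A_term_eq[OF assms, of "int (Suc k)"]
    by (simp add: polylog_term_def del: power_Suc of_nat_Suc)
qed

lemma A_term_neg:
  assumes "q \<in> {-1, 0, 1}"
  shows "A_term l lam m \<mu> \<alpha> q (- int (Suc k)) =
    - A_prefactor l lam m \<mu> q * sph_harm (l + lam) (m - \<mu>) (pi / 2) 0
    * polylog_term (l + lam) (exp (\<i> * of_real \<alpha>)) k"
proof -
  have "exp (- \<i> * of_int (- int (Suc k)) * of_real \<alpha>) = exp (\<i> * of_real \<alpha>) ^ Suc k"
    by (subst exp_of_nat_mult[symmetric]) (simp add: mult_ac del: of_nat_Suc)
  then show ?thesis
    using A_term_eq[OF assms, of "- int (Suc k)"]
    by (simp add: polylog_term_def del: power_Suc of_nat_Suc)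
qed

text \<open>Pulling out the constant is possible as soon as the multiplied series converges; for
  \<open>c = 0\<close> both sides vanish, even when \<open>f\<close> itself is not summable.\<close>

lemma suminf_cmult_of_summable_cmult:
  fixes f :: "nat \<Rightarrow> complex"
  assumes "summable (\<lambda>k. c * f k)"
  shows "(\<Sum>k. c * f k) = c * (\<Sum>k. f k)"
  using assms by (cases "c = 0") (auto intro: suminf_mult)

theorem lemma5p4:
  fixes l lam :: nat and m \<mu> q :: int and \<alpha> :: real
  assumes "\<bar>m\<bar> \<le> int l" and "\<bar>\<mu>\<bar> \<le> int lam" and "q \<in> {-1, 0, 1}"
  shows
    "(l + lam \<ge> 2 \<or> (l + lam = 1 \<and> exp (\<i> * of_real \<alpha>) \<noteq> 1) \<longrightarrow>
        summable (polylog_term (l + lam) (exp (- \<i> * of_real \<alpha>))) \<and>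
        summable (polylog_term (l + lam) (exp (\<i> * of_real \<alpha>))) \<and>
        summable_nz (A_term l lam m \<mu> \<alpha> q)) \<and>
     (summable_nz (A_term l lam m \<mu> \<alpha> q) \<longrightarrow>
        A_series l lam m \<mu> \<alpha> q =
          (-1) powi (int lam + \<mu>) * of_real (eps q)
          * of_real (sqrt ((2 * real l + 1) / (2 * real lam + 1)))
          * of_real (binom_factor l lam m \<mu>)
          * of_real (sqrt (4 * pi / (2 * real (l + lam) + 1)))
          * (polylog (l + lam) (exp (- \<i> * of_real \<alpha>)) * sph_harm (l + lam) (m - \<mu>) (pi / 2) pi
             - polylog (l + lam) (exp (\<i> * of_real \<alpha>)) * sph_harm (l + lam) (m - \<mu>) (pi / 2) 0))"
proof (intro conjI impI)
  let ?L = "l + lam"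
  let ?w = "exp (- \<i> * of_real \<alpha>)" and ?z = "exp (\<i> * of_real \<alpha>)"
  let ?C = "A_prefactor l lam m \<mu> q"
  let ?Ypos = "sph_harm ?L (m - \<mu>) (pi / 2) pi" and ?Yneg = "sph_harm ?L (m - \<mu>) (pi / 2) 0"
  note terms = A_term_pos[OF assms(3)] A_term_neg[OF assms(3)]
  {
    assume L: "?L \<ge> 2 \<or> (?L = 1 \<and> ?z \<noteq> 1)"
    have "?w = inverse ?z"
      by (simp add: exp_minus)
    with L have "?L \<ge> 2 \<or> (?L = 1 \<and> ?w \<noteq> 1)"
      by auto
    then show w: "summable (polylog_term ?L ?w)"
      by (intro summable_polylog_term) simp_all
    from L show z: "summable (polylog_term ?L ?z)"
      by (intro summable_polylog_term) simp_all
    from w z show "summable_nz (A_term l lam m \<mu> \<alpha> q)"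
      unfolding summable_nz_def terms by (intro conjI summable_mult)
  next
    assume "summable_nz (A_term l lam m \<mu> \<alpha> q)"
    then have "A_series l lam m \<mu> \<alpha> q = ?C * ?Ypos * polylog ?L ?w + - ?C * ?Yneg * polylog ?L ?z"
      unfolding summable_nz_def A_series_def suminf_nz_def terms polylog_def
      by (simp only: suminf_cmult_of_summable_cmult)
    also have "\<dots> = ?C * (polylog ?L ?w * ?Ypos - polylog ?L ?z * ?Yneg)"
      by (simp add: algebra_simps)
    finally show "A_series l lam m \<mu> \<alpha> q =
          (-1) powi (int lam + \<mu>) * of_real (eps q)
          * of_real (sqrt ((2 * real l + 1) / (2 * real lam + 1)))
          * of_real (binom_factor l lam m \<mu>)
          * of_real (sqrt (4 * pi / (2 * real (l + lam) + 1)))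
          * (polylog ?L ?w * ?Ypos - polylog ?L ?z * ?Yneg)"
      unfolding A_prefactor_def .
  }
qed

end
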